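(* Let $N,r$ be positive integers, let $p$ be a prime number, and put $A:=(\mathbb{Z}/p\mathbb{Z})^N$. For each $1\le j\le r$ let $$B_j=\bigoplus_{k=1}^{K(j)}\mathbb{Z}/p^{\beta_{j,k}}\mathbb{Z}\quad\text{with } K(j)\ge 1 \text{ and } \beta_{j,1}\ge\dots\ge\beta_{j,K(j)}\ge 1,$$ and let $f_j:A\to B_j$ be a nonzero function (not identically zero). Put $Z:=\{x\in A\mid f_1(x)=0,\dots,f_r(x)=0\}$. Then $$\operatorname{ord}_p(\#Z)\;\ge\;\left\lceil\frac{N-\sum_{j=1}^r\operatorname{fdeg}(f_j)\sum_{k=1}^{K(j)}\frac{p^{\beta_{j,k}}-1}{p-1}}{\max_{1\le j\le r}\,p^{\beta_{j,1}-1}\operatorname{fdeg}(f_j)}\right\rceil .$$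
   Context: For commutative groups $A,B$, a function $f:A\to B$ and $a\in A$, let $\Delta_a f:A\to B$ be $\Delta_a f(x)=f(x+a)-f(x)$. The functional degree is $$\operatorname{fdeg}(f)=\sup\{n\in\mathbb{N}\mid \exists\, a_1,\dots,a_n\in A,\ \Delta_{a_1}\cdots\Delta_{a_n}f\ne 0\}\in\mathbb{N}\cup\{-\infty,\infty\},$$ where $\mathbb{N}=\{0,1,2,\dots\}$ and $\sup\emptyset=-\infty$. (In the situation of the claim all functional degrees are finite and non-negative.) For a nonzero integer $m$, $\operatorname{ord}_p(m)$ is the exponent of the largest power of $p$ dividing $m$, and $\operatorname{ord}_p(0)=\infty$. If the maximum in the denominator is $0$ (all $f_j$ are nonzero constants), the right-hand side is read as $+\infty$. *)

theory Defs
  imports "HOL-Algebra.Product_Groups" "HOL-Library.Extended_Real"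
    "HOL-Computational_Algebra.Primes"
begin

text \<open>Commutative groups are HOL-Algebra structures, written multiplicatively: the group law
  \<open>\<otimes>\<close> is the addition and \<open>\<one>\<close> is the zero element. Functions between groups matter only on
  the carrier of their domain.\<close>

definition fdelta ::
    "('a, 'c) monoid_scheme \<Rightarrow> ('b, 'd) monoid_scheme \<Rightarrow> 'a \<Rightarrow> ('a \<Rightarrow> 'b) \<Rightarrow> 'a \<Rightarrow> 'b" where
  "fdelta A B a f = (\<lambda>x. f (x \<otimes>\<^bsub>A\<^esub> a) \<otimes>\<^bsub>B\<^esub> inv\<^bsub>B\<^esub> (f x))"

text \<open>The list \<open>[a\<^sub>1, \<dots>, a\<^sub>n]\<close> encodes the iterated difference
  \<open>\<Delta>\<^bsub>a\<^sub>1\<^esub> \<cdots> \<Delta>\<^bsub>a\<^sub>n\<^esub> f\<close>; the supremum is taken in the extended reals, where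
  \<open>Sup {} = - \<infinity>\<close>.\<close>

definition fdeg ::
    "('a, 'c) monoid_scheme \<Rightarrow> ('b, 'd) monoid_scheme \<Rightarrow> ('a \<Rightarrow> 'b) \<Rightarrow> ereal" where
  "fdeg A B f = Sup {ereal (real n) | n. \<exists>as. length as = n \<and> set as \<subseteq> carrier A \<and>
     (\<exists>x\<in>carrier A. foldr (fdelta A B) as f x \<noteq> \<one>\<^bsub>B\<^esub>)}"

definition elem_ab_group :: "nat \<Rightarrow> nat \<Rightarrow> (nat \<Rightarrow> int) monoid" where
  "elem_ab_group p N = product_group {1..N} (\<lambda>_. integer_mod_group p)"

definition ab_p_group :: "nat \<Rightarrow> nat \<Rightarrow> (nat \<Rightarrow> nat) \<Rightarrow> (nat \<Rightarrow> int) monoid" where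
  "ab_p_group p K \<beta> = sum_group {1..K} (\<lambda>k. integer_mod_group (p ^ \<beta> k))"

definition padic_ord :: "nat \<Rightarrow> nat \<Rightarrow> ereal" where
  "padic_ord p m = (if m = 0 then \<infinity> else ereal (real (multiplicity p m)))"

definition ereal_ceiling :: "ereal \<Rightarrow> ereal" where
  "ereal_ceiling x = (if \<bar>x\<bar> = \<infinity> then x else ereal (real_of_int \<lceil>real_of_ereal x\<rceil>))"

end

theory Submission
  imports Defs "HOL-Library.Function_Algebras" "HOL-Computational_Algebra.Polynomial"
begin

text \<open>
  Identify \<open>A\<close> with the box \<open>{0, \<dots>, p - 1}\<^sup>N\<close>. By Newton's forward difference formula each component
  of \<open>f\<^sub>j\<close> is congruent, modulo \<open>p\<^bsup>\<beta>\<^esup>\<close>, to an integer valued function \<open>F\<close> on the box whose differences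
  of order greater than \<open>fdeg f\<^sub>j\<close> vanish exactly. The indicator function of \<open>p\<^bsup>\<beta>\<^esup> dvd y\<close> expands as
  \<open>\<Sum>n. c\<^sub>n * (y choose n)\<close>, where \<open>c\<^sub>n\<close> is highly divisible by \<open>p\<close> for large \<open>n\<close>; this comes from
  computing with \<open>(X - 1)\<^bsup>n\<^esup>\<close> modulo \<open>X\<^bsup>p^\<beta>\<^esup> - 1\<close>. Hence \<open>#Z\<close> is a combination of sums over the box of
  products of binomial coefficients \<open>F choose n\<close>, and the sum over the box of an integer valued function
  of degree \<open>S\<close> is divisible by \<open>p\<close> to the power \<open>N - \<lfloor>S / (p - 1)\<rfloor>\<close>. The divisibility of the
  coefficients makes up for the loss incurred by large degrees.
\<close>

subsection \<open>Iterated differences of integer valued functions\<close>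

text \<open>The domain is only a commutative monoid. This admits vectors of naturals, on which
  nonconstant integer valued functions can have vanishing higher differences; on a finite group they
  cannot.\<close>

definition diff_at :: "'a::comm_monoid_add \<Rightarrow> ('a \<Rightarrow> int) \<Rightarrow> 'a \<Rightarrow> int" where
  "diff_at a g = (\<lambda>x. g (x + a) - g x)"

text \<open>For \<open>q = 0\<close> divisibility by \<open>q\<close> means vanishing, so \<open>fdeg_less 0 n g\<close> is the
  statement \<open>fdeg g < n\<close> over the integers.\<close>
primrec fdeg_less :: "int \<Rightarrow> nat \<Rightarrow> ('a::comm_monoid_add \<Rightarrow> int) \<Rightarrow> bool" where
  "fdeg_less q 0 g = (\<forall>x. q dvd g x)"
| "fdeg_less q (Suc n) g = (\<forall>a. fdeg_less q n (diff_at a g))"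

lemma fdeg_less_zero [simp]: "fdeg_less q n (\<lambda>x. 0)"
  by (induction n) (simp_all add: diff_at_def)

lemma fdeg_less_add:
  "fdeg_less q n g \<Longrightarrow> fdeg_less q n h \<Longrightarrow> fdeg_less q n (\<lambda>x. g x + h x)"
proof (induction n arbitrary: g h)
  case (Suc n)
  have "diff_at a (\<lambda>x. g x + h x) = (\<lambda>x. diff_at a g x + diff_at a h x)" for a
    by (simp add: diff_at_def fun_eq_iff)
  with Suc show ?case by simp
qed simp

lemma fdeg_less_sum:
  "(\<And>i. i \<in> I \<Longrightarrow> fdeg_less q n (g i)) \<Longrightarrow> fdeg_less q n (\<lambda>x. \<Sum>i\<in>I. g i x)"
  by (induction I rule: infinite_finite_induct) (simp_all add: fdeg_less_add)

lemma fdeg_less_cmult: "fdeg_less q n g \<Longrightarrow> fdeg_less q n (\<lambda>x. c * g x)"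
proof (induction n arbitrary: g)
  case (Suc n)
  have "diff_at a (\<lambda>x. c * g x) = (\<lambda>x. c * diff_at a g x)" for a
    by (simp add: diff_at_def fun_eq_iff algebra_simps)
  with Suc show ?case by simp
qed simp

text \<open>With modulus 0 the terminal condition is vanishing, so a nonzero integer factor cancels.
  This removes \<open>fact n\<close> in \<open>fdeg_less_binomial\<close>.\<close>

lemma fdeg_less_cmult_cancel:
  "c \<noteq> 0 \<Longrightarrow> fdeg_less 0 n (\<lambda>x. c * g x) \<Longrightarrow> fdeg_less 0 n g"
proof (induction n arbitrary: g)
  case (Suc n)
  have "diff_at a (\<lambda>x. c * g x) = (\<lambda>x. c * diff_at a g x)" for a
    by (simp add: diff_at_def fun_eq_iff algebra_simps)
  with Suc show ?case by simp
qed simp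

lemma fdeg_less_shift: "fdeg_less q n g \<Longrightarrow> fdeg_less q n (\<lambda>x. g (x + b))"
proof (induction n arbitrary: g)
  case (Suc n)
  have "diff_at a (\<lambda>x. g (x + b)) = (\<lambda>x. diff_at a g (x + b))" for a
    by (simp add: diff_at_def fun_eq_iff ac_simps)
  with Suc show ?case by simp
qed simp

lemma fdeg_less_diff_at: "fdeg_less q n g \<Longrightarrow> fdeg_less q n (diff_at a g)"
  using fdeg_less_add[OF fdeg_less_shift[of q n g a] fdeg_less_cmult[of q n g "-1"]]
  by (simp add: diff_at_def)

lemma fdeg_less_mono: "m \<le> n \<Longrightarrow> fdeg_less q m g \<Longrightarrow> fdeg_less q n g"
  by (induction rule: dec_induct) (auto intro: fdeg_less_diff_at)

text \<open>From \<open>k = n\<close> on, the truncated \<open>n - k\<close> is 0 and the claim is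
  that \<open>q\<close> divides all values, a property that further differences keep.\<close>

lemma fdeg_less_diff_at_funpow: "fdeg_less q n g \<Longrightarrow> fdeg_less q (n - k) ((diff_at a ^^ k) g)"
proof (induction k)
  case (Suc k)
  then have *: "fdeg_less q (n - k) ((diff_at a ^^ k) g)" by simp
  show ?case
  proof (cases "n - k")
    case 0
    then show ?thesis using fdeg_less_diff_at[OF *, of a] by simp
  next
    case (Suc m)
    then have "n - Suc k = m" by simp
    then show ?thesis using * Suc by simp
  qed
qed simp

lemma fdeg_less_const: "fdeg_less q (Suc n) (\<lambda>x. c)"
  by (simp add: diff_at_def)

text \<open>By the Leibniz rule, each summand of a difference of the product lowers the bound of one
  factor, so induction on \<open>m + n\<close> applies. A factor whose bound drops to 0 has all
  values divisible by \<open>q\<close>, and so has the summand.\<close>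

lemma fdeg_less_mult:
  "fdeg_less q (Suc m) g \<Longrightarrow> fdeg_less q (Suc n) h \<Longrightarrow> fdeg_less q (Suc (m + n)) (\<lambda>x. g x * h x)"
proof (induction "m + n" arbitrary: m n g h)
  case 0
  have "diff_at a (\<lambda>x. g x * h x) = (\<lambda>x. diff_at a g x * h (x + a) + g x * diff_at a h x)" for a
    by (simp add: diff_at_def fun_eq_iff algebra_simps)
  with 0 show ?case by simp
next
  case (Suc k)
  have eq: "diff_at a (\<lambda>x. g x * h x) = (\<lambda>x. diff_at a g x * h (x + a) + g x * diff_at a h x)" for a
    by (simp add: diff_at_def fun_eq_iff algebra_simps)
  have "fdeg_less q (m + n) (\<lambda>x. diff_at a g x * h (x + a) + g x * diff_at a h x)" for a
  proof (rule fdeg_less_add)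
    have h': "fdeg_less q (Suc n) (\<lambda>x. h (x + a))" using Suc.prems(2) by (rule fdeg_less_shift)
    show "fdeg_less q (m + n) (\<lambda>x. diff_at a g x * h (x + a))"
    proof (cases m)
      case 0
      then have "q dvd diff_at a g x" for x using Suc.prems(1) by simp
      then have "fdeg_less q 0 (\<lambda>x. diff_at a g x * h (x + a))" by simp
      then show ?thesis by (rule fdeg_less_mono[rotated]) simp
    next
      case (Suc m')
      with Suc.prems(1) have "fdeg_less q (Suc m') (diff_at a g)" by simp
      from Suc.hyps(1)[OF _ this h'] Suc.hyps(2) Suc show ?thesis by simp
    qed
    show "fdeg_less q (m + n) (\<lambda>x. g x * diff_at a h x)"
    proof (cases n)
      case 0
      then have "q dvd diff_at a h x" for x using Suc.prems(2) by simp
      then have "fdeg_less q 0 (\<lambda>x. g x * diff_at a h x)" by simp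
      then show ?thesis by (rule fdeg_less_mono[rotated]) simp
    next
      case (Suc n')
      with Suc.prems(2) have "fdeg_less q (Suc n') (diff_at a h)" by simp
      from Suc.hyps(1)[OF _ Suc.prems(1) this] Suc.hyps(2) Suc show ?thesis by simp
    qed
  qed
  then show ?case by (simp add: eq)
qed

lemma fdeg_less_prod:
  "finite I \<Longrightarrow> (\<And>i. i \<in> I \<Longrightarrow> fdeg_less q (Suc (m i)) (g i)) \<Longrightarrow>
    fdeg_less q (Suc (\<Sum>i\<in>I. m i)) (\<lambda>x. \<Prod>i\<in>I. g i x)"
proof (induction I rule: finite_induct)
  case (insert i I)
  then show ?case
    using fdeg_less_mult[of q "m i" "g i" "\<Sum>i\<in>I. m i" "\<lambda>x. \<Prod>i\<in>I. g i x"] by simp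
qed (simp add: diff_at_def)

lemma fact_mult_binomial_int: "fact n * int (m choose n) = (\<Prod>i<n. int m - int i)"
  using gbinomial_int_mult_fact[of n "int m"]
  by (simp add: int_binomial atLeast0LessThan)

text \<open>Up to the factor \<open>fact n\<close>, the binomial coefficient is a product of
  \<open>n\<close> factors \<open>G x - i\<close>, each of degree at most \<open>d\<close>.\<close>

lemma fdeg_less_binomial:
  assumes "fdeg_less 0 (Suc d) (\<lambda>x. int (G x))"
  shows "fdeg_less 0 (Suc (d * n)) (\<lambda>x. int (G x choose n))"
proof -
  have "fdeg_less 0 (Suc d) (\<lambda>x. int (G x) + - int i)" for i
    by (intro fdeg_less_add assms fdeg_less_const)
  then have "fdeg_less 0 (Suc (\<Sum>i<n. d)) (\<lambda>x. \<Prod>i<n. int (G x) - int i)"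
    by (intro fdeg_less_prod) auto
  then have "fdeg_less 0 (Suc (d * n)) (\<lambda>x. fact n * int (G x choose n))"
    by (simp add: fact_mult_binomial_int mult.commute)
  then show ?thesis by (rule fdeg_less_cmult_cancel[rotated]) simp
qed

text \<open>Serves the projection that sets one coordinate to 0 in
  \<open>integer_lift\<close>.\<close>

lemma fdeg_less_compose_additive:
  assumes "\<And>x y. \<pi> (x + y) = \<pi> x + \<pi> y"
  shows "fdeg_less q n g \<Longrightarrow> fdeg_less q n (\<lambda>x. g (\<pi> x))"
proof (induction n arbitrary: g)
  case (Suc n)
  have "diff_at a (\<lambda>x. g (\<pi> x)) = (\<lambda>x. diff_at (\<pi> a) g (\<pi> x))" for a
    by (simp add: diff_at_def fun_eq_iff assms)
  with Suc show ?case by simp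
qed simp

lemma fdeg_less_if_foldr:
  assumes "\<And>as x. length as = n \<Longrightarrow> q dvd foldr diff_at as g x"
  shows "fdeg_less q n g"
  using assms
proof (induction n arbitrary: g)
  case (Suc n)
  have "fdeg_less q n (diff_at a g)" for a
  proof (rule Suc.IH)
    fix as x assume "length (as :: 'a list) = n"
    then show "q dvd foldr diff_at as (diff_at a g) x"
      \<comment> \<open>\<open>foldr\<close> applies the last list entry first, so the innermost
        difference is appended at the end.\<close>
      using Suc.prems[of "as @ [a]" x] by simp
  qed
  then show ?case by simp
qed simp

section \<open>Newton's forward difference formula and its summed form\<close>

lemma newton_forward:
  "g (((\<lambda>x. x + a) ^^ s) x) = (\<Sum>k\<le>s. int (s choose k) * (diff_at a ^^ k) g x)"
proof (induction s arbitrary: g)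
  case (Suc s)
  have "g (((\<lambda>x. x + a) ^^ Suc s) x) =
      g (((\<lambda>x. x + a) ^^ s) x) + diff_at a g (((\<lambda>x. x + a) ^^ s) x)"
    by (simp add: diff_at_def)
  also have "\<dots> = (\<Sum>k\<le>s. int (s choose k) * (diff_at a ^^ k) g x)
      + (\<Sum>k\<le>s. int (s choose k) * (diff_at a ^^ Suc k) g x)"
    by (simp only: Suc.IH funpow_Suc_right o_apply)
  also have "(\<Sum>k\<le>s. int (s choose k) * (diff_at a ^^ k) g x) =
      (\<Sum>k\<le>Suc s. int (s choose k) * (diff_at a ^^ k) g x)"
    by simp
  also have "\<dots> = g x + (\<Sum>k\<le>s. int (s choose Suc k) * (diff_at a ^^ Suc k) g x)"
    by (subst sum.atMost_Suc_shift) simp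
  finally have "g (((\<lambda>x. x + a) ^^ Suc s) x) =
      g x + (\<Sum>k\<le>s. int (Suc s choose Suc k) * (diff_at a ^^ Suc k) g x)"
    by (simp add: sum.distrib[symmetric] algebra_simps)
  then show ?case
    by (subst sum.atMost_Suc_shift) simp
qed simp

text \<open>Summing Newton's formula over \<open>s\<close> adds up binomial coefficients along a
  column (hockey stick identity). For \<open>n\<close> prime, all resulting coefficients but the
  last are divisible by \<open>n\<close>.\<close>

lemma newton_forward_sum:
  "(\<Sum>s<n. g (((\<lambda>x. x + a) ^^ s) x)) = (\<Sum>k<n. int (n choose Suc k) * (diff_at a ^^ k) g x)"
proof (induction n)
  case (Suc n)
  have "(\<Sum>s<Suc n. g (((\<lambda>x. x + a) ^^ s) x)) =
      (\<Sum>k\<le>n. int (n choose Suc k) * (diff_at a ^^ k) g x) + g (((\<lambda>x. x + a) ^^ n) x)"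
    using Suc by (simp add: lessThan_Suc_atMost[symmetric])
  also have "\<dots> = (\<Sum>k\<le>n. int (Suc n choose Suc k) * (diff_at a ^^ k) g x)"
    unfolding newton_forward by (simp add: sum.distrib[symmetric] algebra_simps)
  finally show ?case by (simp only: lessThan_Suc_atMost)
qed simp

subsection \<open>Sums over boxes and integer lifts\<close>

text \<open>Coordinates outside \<open>I\<close> are pinned to 0, so that the functions stay defined
  on one type while the dimension varies in inductions on \<open>I\<close>.\<close>

definition box :: "nat \<Rightarrow> 'i set \<Rightarrow> ('i \<Rightarrow> nat) set" where
  "box p I = {x. (\<forall>i\<in>I. x i < p) \<and> (\<forall>i. i \<notin> I \<longrightarrow> x i = 0)}"

definition unit_vec :: "'i \<Rightarrow> 'i \<Rightarrow> nat" where
  "unit_vec i = (\<lambda>k. if k = i then 1 else 0)"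

lemma funpow_add_unit_vec: "((\<lambda>x. x + unit_vec i) ^^ s) x = x(i := x i + s)"
  by (induction s) (auto simp: unit_vec_def fun_eq_iff)

lemma sum_box_insert:
  assumes "i \<notin> I"
  shows "(\<Sum>x\<in>box p (insert i I). g x) = (\<Sum>y\<in>box p I. \<Sum>s<p. g (y(i := s)))"
  unfolding sum.cartesian_product
  by (rule sum.reindex_bij_witness[where i = "\<lambda>(y, s). y(i := s)" and j = "\<lambda>x. (x(i := 0), x i)"])
    (use assms in \<open>auto simp: box_def fun_eq_iff\<close>)

text \<open>Summing over one coordinate leaves \<open>p\<close> times a combination of differences
  plus the difference of order \<open>p - 1\<close>. The first part gains a factor \<open>p\<close>
  at the same \<open>t\<close>; the second lowers \<open>t\<close> by one. Either way the exponent
  rises by one with the dimension.\<close>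

lemma prime_power_dvd_sum_box:
  assumes "prime p" "finite I"
  shows "fdeg_less 0 ((p - 1) * t) g \<Longrightarrow> int p ^ (card I + 1 - t) dvd (\<Sum>x\<in>box p I. g x)"
  using assms(2)
proof (induction I arbitrary: t g rule: finite_induct)
  case empty
  then show ?case
    by (cases t) (auto simp: box_def)
next
  case (insert i I)
  define m where "m = p - 1"
  have p: "p = Suc m" using prime_gt_0_nat[OF assms(1)] by (simp add: m_def)
  let ?D = "\<lambda>k. (diff_at (unit_vec i) ^^ k) g"
  define b where "b = (\<lambda>k. int ((p choose Suc k) div p))"
  have b: "int (p choose Suc k) = int p * b k" if "k < m" for k
  proof -
    have "p dvd (p choose Suc k)"
      by (rule dvd_choose_prime) (use that p assms(1) in auto)
    then show ?thesis by (simp add: b_def flip: of_nat_mult)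
  qed
  define h where "h = (\<lambda>y. \<Sum>k<m. b k * ?D k y)"
  have "(\<Sum>s<p. g (y(i := s))) = int p * h y + ?D m y" if "y \<in> box p I" for y
  proof -
    have "y i = 0" using that insert.hyps by (auto simp: box_def)
    then have "(\<Sum>s<p. g (y(i := s))) = (\<Sum>k<p. int (p choose Suc k) * ?D k y)"
      using newton_forward_sum[of g "unit_vec i" y p] by (simp add: funpow_add_unit_vec)
    also have "\<dots> = (\<Sum>k<m. int (p choose Suc k) * ?D k y) + ?D m y"
      by (simp add: p)
    finally show ?thesis by (simp add: h_def b sum_distrib_left mult.assoc)
  qed
  then have eq: "(\<Sum>x\<in>box p (insert i I). g x) =
      int p * (\<Sum>y\<in>box p I. h y) + (\<Sum>y\<in>box p I. ?D m y)"
    using insert.hyps by (simp add: sum_box_insert sum.distrib sum_distrib_left)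
  have D: "fdeg_less 0 ((p - 1) * t - k) (?D k)" for k
    using insert.prems by (rule fdeg_less_diff_at_funpow)
  then have D': "fdeg_less 0 ((p - 1) * t) (?D k)" for k
    by (rule fdeg_less_mono[OF diff_le_self])
  have "fdeg_less 0 ((p - 1) * t) h"
    unfolding h_def by (intro fdeg_less_sum fdeg_less_cmult D')
  from insert.IH[OF this] have "int p * int p ^ (card I + 1 - t) dvd int p * (\<Sum>y\<in>box p I. h y)"
    by (rule mult_dvd_mono[OF dvd_refl])
  then have "int p ^ Suc (card I + 1 - t) dvd int p * (\<Sum>y\<in>box p I. h y)" by simp
  \<comment> \<open>For \<open>t > card I + 1\<close> truncation makes the required exponent smaller
    than the one at hand, hence the detour through divisibility of powers.\<close>
  then have 1: "int p ^ (Suc (card I) + 1 - t) dvd int p * (\<Sum>y\<in>box p I. h y)"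
    by (rule dvd_trans[OF le_imp_power_dvd, rotated]) simp
  have 2: "int p ^ (Suc (card I) + 1 - t) dvd (\<Sum>y\<in>box p I. ?D m y)"
  proof (cases t)
    case 0
    with D'[of m] show ?thesis by simp
  next
    case (Suc u)
    then have "(p - 1) * t - m = (p - 1) * u" by (simp add: m_def)
    with D[of m] have "fdeg_less 0 ((p - 1) * u) (?D m)" by metis
    from insert.IH[OF this] Suc show ?thesis by simp
  qed
  show ?case using dvd_add[OF 1 2] insert.hyps by (simp add: eq)
qed

lemma fdeg_less_coordinate: "fdeg_less 0 2 (\<lambda>x :: 'i \<Rightarrow> nat. int (x i))"
  by (simp add: numeral_2_eq_2 diff_at_def)

text \<open>Newton's formula in one coordinate has as coefficients differences on a hyperplane,
  which lift by induction on the dimension. Values of \<open>F\<close> are naturals so that binomial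
  coefficients of them can be formed.\<close>

lemma integer_lift:
  assumes "q > 0" "finite I"
  shows "fdeg_less q n g \<Longrightarrow> \<exists>F. fdeg_less 0 n (\<lambda>x. int (F x)) \<and>
    (\<forall>x\<in>box p I. q dvd int (F x) - g x)"
  using assms(2)
proof (induction I arbitrary: n g rule: finite_induct)
  case empty
  show ?case
  proof (cases n)
    case 0
    with empty show ?thesis by (intro exI[of _ "\<lambda>x. 0"]) auto
  next
    case (Suc m)
    then have "fdeg_less 0 n (\<lambda>x. int (nat (g (\<lambda>_. 0) mod q)))"
      by (simp only: fdeg_less_const)
    moreover have "x = (\<lambda>_. 0)" if "x \<in> box p {}" for x :: "'a \<Rightarrow> nat"
      using that by (auto simp: box_def)
    ultimately show ?thesis
      using assms(1) by (intro exI[of _ "\<lambda>x. nat (g (\<lambda>_. 0) mod q)"])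
        (auto simp: mod_eq_dvd_iff[symmetric])
  qed
next
  case (insert i I)
  let ?D = "\<lambda>k. (diff_at (unit_vec i) ^^ k) g"
  have "\<exists>F. fdeg_less 0 (n - k) (\<lambda>x. int (F x)) \<and> (\<forall>x\<in>box p I. q dvd int (F x) - ?D k x)" for k
    by (rule insert.IH[OF fdeg_less_diff_at_funpow[OF insert.prems]])
  then obtain F where F: "\<And>k. fdeg_less 0 (n - k) (\<lambda>x. int (F k x))"
    and Fq: "\<And>k x. x \<in> box p I \<Longrightarrow> q dvd int (F k x) - ?D k x"
    by metis
  \<comment> \<open>The binomial factor has degree \<open>k\<close> and the lifted coefficient
    degree below \<open>n - k\<close>, so each product stays below \<open>n\<close>. The range
    \<open>k < p\<close> is enough since coordinates in the box are less than
    \<open>p\<close>.\<close>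
  define G where "G = (\<lambda>x. \<Sum>k<p. (x i choose k) * F k (x(i := 0)))"
  have "fdeg_less 0 n (\<lambda>x. int (x i choose k) * int (F k (x(i := 0))))" for k
  proof -
    have 1: "fdeg_less 0 (Suc k) (\<lambda>x. int (x i choose k))"
      using fdeg_less_binomial[of 1 "\<lambda>x. x i" k] fdeg_less_coordinate[of i]
      by (simp only: numeral_2_eq_2 One_nat_def mult_Suc mult_0 add_0_right)
    have 2: "fdeg_less 0 (n - k) (\<lambda>x. int (F k (x(i := 0))))"
      by (rule fdeg_less_compose_additive[OF _ F]) (auto simp: fun_eq_iff)
    show ?thesis
    proof (cases "n - k")
      case 0
      with 2 show ?thesis by simp
    next
      case (Suc m)
      then have "n = Suc (k + m)" by simp
      with fdeg_less_mult[OF 1 2[unfolded Suc]] show ?thesis by metis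
    qed
  qed
  then have "fdeg_less 0 n (\<lambda>x. \<Sum>k<p. int (x i choose k) * int (F k (x(i := 0))))"
    by (rule fdeg_less_sum)
  then have "fdeg_less 0 n (\<lambda>x. int (G x))" by (simp add: G_def)
  moreover have "q dvd int (G x) - g x" if x: "x \<in> box p (insert i I)" for x
  proof -
    let ?y = "x(i := 0)"
    have y: "?y \<in> box p I" and xi: "x i < p" using x insert.hyps by (auto simp: box_def)
    have "g x = (\<Sum>k\<le>x i. int (x i choose k) * ?D k ?y)"
      using newton_forward[where g = g and a = "unit_vec i" and s = "x i" and x = ?y] by (simp add: funpow_add_unit_vec)
    also have "\<dots> = (\<Sum>k<p. int (x i choose k) * ?D k ?y)"
      by (rule sum.mono_neutral_left) (use xi in \<open>auto simp: not_le binomial_eq_0\<close>)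
    finally have "int (G x) - g x = (\<Sum>k<p. int (x i choose k) * (int (F k ?y) - ?D k ?y))"
      by (simp add: G_def sum_subtractf right_diff_distrib)
    also have "q dvd \<dots>" by (intro dvd_sum dvd_mult Fq y)
    finally show ?thesis .
  qed
  ultimately show ?case by blast
qed

subsection \<open>Binomial expansion of the indicator function of a prime power\<close>

lemma power_add_mult_expand:
  fixes u :: "'a::comm_ring_1"
  shows "\<exists>v. (u + c * h) ^ n = u ^ n + c * v"
proof (induction n)
  case 0
  show ?case by (intro exI[of _ 0]) simp
next
  case (Suc n)
  then obtain v where "(u + c * h) ^ n = u ^ n + c * v" by blast
  then have "(u + c * h) ^ Suc n = u ^ Suc n + c * (h * u ^ n + (u + c * h) * v)"
    by (simp add: algebra_simps)
  then show ?case by blast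
qed

text \<open>Expand \<open>((a - 1) + 1) ^ p\<close>: the inner binomial coefficients are divisible
  by \<open>p\<close>, and their terms retain a factor \<open>a - 1\<close>. That factor is what
  \<open>sub_one_power_in_ideal\<close> exploits.\<close>

lemma power_prime_sub_one:
  fixes a :: "'a::comm_ring_1"
  assumes "prime p"
  shows "\<exists>w. a ^ p - 1 = (a - 1) ^ p + of_nat p * ((a - 1) * w)"
proof -
  define u where "u = a - 1"
  obtain m where p: "p = Suc m" using prime_gt_0_nat[OF assms] by (cases p) auto
  define b where "b = (\<lambda>k. (p choose Suc k) div p)"
  have b: "of_nat (p choose Suc k) = (of_nat p * of_nat (b k) :: 'a)" if "k < m" for k
  proof -
    have "p dvd (p choose Suc k)"
      by (rule dvd_choose_prime) (use that p assms in auto)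
    then show ?thesis by (simp add: b_def flip: of_nat_mult)
  qed
  have "a ^ p = (u + 1) ^ p" by (simp add: u_def)
  also have "\<dots> = (\<Sum>k\<le>Suc m. of_nat (p choose k) * u ^ k)"
    unfolding binomial_ring p by simp
  also have "\<dots> = 1 + (\<Sum>k\<le>m. of_nat (p choose Suc k) * u ^ Suc k)"
    by (subst sum.atMost_Suc_shift) simp
  also have "(\<Sum>k\<le>m. of_nat (p choose Suc k) * u ^ Suc k) =
      (\<Sum>k<m. of_nat (p choose Suc k) * u ^ Suc k) + u ^ p"
    unfolding lessThan_Suc_atMost[symmetric] sum.lessThan_Suc by (simp only: p binomial_n_n of_nat_1 mult_1)
  also have "(\<Sum>k<m. of_nat (p choose Suc k) * u ^ Suc k) =
      of_nat p * (u * (\<Sum>k<m. of_nat (b k) * u ^ k))"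
    by (simp add: b sum_distrib_left mult_ac)
  finally have "a ^ p - 1 = u ^ p + of_nat p * (u * (\<Sum>k<m. of_nat (b k) * u ^ k))"
    by simp
  then show ?thesis unfolding u_def by blast
qed

text \<open>Frobenius modulo \<open>p\<close>, applied \<open>b\<close> times.\<close>

lemma sub_one_power_prime_power:
  fixes x :: "'a::comm_ring_1"
  assumes "prime p"
  shows "\<exists>h. (x - 1) ^ (p ^ b) = x ^ (p ^ b) - 1 + of_nat p * h"
proof (induction b)
  case 0
  show ?case by (intro exI[of _ 0]) simp
next
  case (Suc b)
  let ?y = "x ^ (p ^ b)"
  from Suc obtain h where h: "(x - 1) ^ (p ^ b) = ?y - 1 + of_nat p * h" by blast
  obtain w where w: "?y ^ p - 1 = (?y - 1) ^ p + of_nat p * ((?y - 1) * w)"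
    using power_prime_sub_one[OF assms] by blast
  obtain v where v: "((?y - 1) + of_nat p * h) ^ p = (?y - 1) ^ p + of_nat p * v"
    using power_add_mult_expand by blast
  have "(x - 1) ^ (p ^ Suc b) = ((x - 1) ^ (p ^ b)) ^ p"
    by (simp add: mult.commute[of p] flip: power_mult)
  also have "\<dots> = (?y ^ p - 1) + of_nat p * (v - (?y - 1) * w)"
    unfolding h v w by (simp add: algebra_simps)
  also have "?y ^ p = x ^ (p ^ Suc b)"
    by (simp add: mult.commute[of p] flip: power_mult)
  finally show ?case by blast
qed

text \<open>With \<open>u = x\<^bsup>p^b\<^esup> - 1\<close>, the ideal \<open>J = (u, p)\<close> satisfies \<open>J\<^bsup>p\<^esup> \<subseteq> p J\<close>
  modulo \<open>x\<^bsup>p^(b+1)\<^esup> - 1\<close>, and it contains \<open>(x - 1)\<^bsup>p^b\<^esup>\<close>.\<close>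
lemma sub_one_power_in_ideal:
  fixes x :: "'a::comm_ring_1"
  assumes "prime p"
  shows "\<exists>A B C. (x - 1) ^ (p ^ b * (1 + e * (p - 1))) =
    of_nat p ^ e * ((x ^ (p ^ b) - 1) * A + of_nat p * B) + (x ^ (p ^ Suc b) - 1) * C"
proof -
  define u where "u = x ^ (p ^ b) - 1"
  define T where "T = x ^ (p ^ Suc b) - 1"
  define z where "z = (x - 1) ^ (p ^ b)"
  obtain m where p: "p = Suc (Suc m)"
    using prime_ge_2_nat[OF assms] by (metis add_2_eq_Suc le_Suc_ex)
  obtain h where h: "z = u + of_nat p * h"
    using sub_one_power_prime_power[OF assms] unfolding z_def u_def by blast
  obtain w where "(x ^ (p ^ b)) ^ p - 1 = u ^ p + of_nat p * (u * w)"
    using power_prime_sub_one[OF assms, of "x ^ (p ^ b)"] unfolding u_def by blast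
  moreover have "(x ^ (p ^ b)) ^ p = x ^ (p ^ Suc b)"
    by (simp add: mult.commute[of p] flip: power_mult)
  moreover have "u ^ p = u * u ^ (p - 1)" by (simp add: p)
  ultimately have w: "u * u ^ (p - 1) = T - of_nat p * (u * w)"
    by (simp add: T_def algebra_simps)
  obtain h' where h': "z ^ (p - 1) = u ^ (p - 1) + of_nat p * h'"
    using power_add_mult_expand unfolding h by blast
  \<comment> \<open>As \<open>p >= 2\<close>, one factor \<open>z\<close>, which lies in the ideal
    \<open>(u, p)\<close>, can be split off from \<open>z ^ (p - 1)\<close>.\<close>
  define v where "v = z ^ m"
  have v: "z ^ (p - 1) = v * (u + of_nat p * h)"
    unfolding h[symmetric] by (simp add: v_def p mult.commute)
  have "\<exists>A B C. z ^ (1 + e * (p - 1)) = of_nat p ^ e * (u * A + of_nat p * B) + T * C"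
  proof (induction e)
    case 0
    show ?case by (rule exI[of _ 1], rule exI[of _ h], rule exI[of _ 0]) (simp add: h)
  next
    case (Suc e)
    then obtain A B C where
      IH: "z ^ (1 + e * (p - 1)) = of_nat p ^ e * (u * A + of_nat p * B) + T * C" by blast
    \<comment> \<open>Modulo \<open>T\<close> the power \<open>u ^ p\<close> is a multiple of
      \<open>p * u\<close>, so multiplying \<open>u\<close> by \<open>z ^ (p - 1)\<close> yields a
      factor \<open>p\<close> and keeps \<open>u\<close>.\<close>
    have uz: "u * z ^ (p - 1) = T + of_nat p * (u * (h' - w))"
      unfolding h' distrib_left w by (simp add: algebra_simps)
    have "u * A * z ^ (p - 1) = A * (u * z ^ (p - 1))" by (simp only: mult_ac)
    also have "\<dots> = A * T + of_nat p * (u * (A * (h' - w)))"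
      unfolding uz by (simp add: algebra_simps)
    finally have uA: "u * A * z ^ (p - 1) = A * T + of_nat p * (u * (A * (h' - w)))" .
    have pB: "of_nat p * B * z ^ (p - 1) = of_nat p * (u * (B * v) + of_nat p * (B * v * h))"
      unfolding v by (simp add: algebra_simps)
    have "z ^ (1 + Suc e * (p - 1)) = z ^ (1 + e * (p - 1)) * z ^ (p - 1)"
      by (simp add: power_add mult_ac)
    also have "\<dots> = of_nat p ^ e * (u * A * z ^ (p - 1) + of_nat p * B * z ^ (p - 1))
        + T * (C * z ^ (p - 1))"
      unfolding IH by (simp only: distrib_left distrib_right mult_ac)
    also have "\<dots> = of_nat p ^ Suc e * (u * (A * (h' - w) + B * v) + of_nat p * (B * v * h))
        + T * (of_nat p ^ e * A + C * z ^ (p - 1))"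
      unfolding uA pB by (simp add: algebra_simps)
    finally show ?case by blast
  qed
  then show ?thesis by (simp only: z_def u_def T_def power_mult)
qed

text \<open>Umbral evaluation: the linear functional sending the \<open>i\<close>-th power of the
  variable to \<open>\<chi> i\<close>. If \<open>\<chi>\<close> has period \<open>q\<close>, it
  kills all multiples of \<open>X ^ q - 1\<close>.\<close>

definition coeff_functional :: "(nat \<Rightarrow> int) \<Rightarrow> int poly \<Rightarrow> int" where
  "coeff_functional \<chi> P = (\<Sum>i\<le>degree P. coeff P i * \<chi> i)"

lemma coeff_functional_eq:
  assumes "degree P \<le> M"
  shows "coeff_functional \<chi> P = (\<Sum>i\<le>M. coeff P i * \<chi> i)"
  unfolding coeff_functional_def
  by (rule sum.mono_neutral_left) (use assms in \<open>auto simp: coeff_eq_0\<close>)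

lemma coeff_functional_0 [simp]: "coeff_functional \<chi> 0 = 0"
  by (simp add: coeff_functional_def)

lemma coeff_functional_add:
  "coeff_functional \<chi> (P + Q) = coeff_functional \<chi> P + coeff_functional \<chi> Q"
  using degree_add_le_max[of P Q]
  by (simp add: coeff_functional_eq[where M = "max (degree P) (degree Q)"]
      sum.distrib[symmetric] distrib_right)

lemma coeff_functional_smult: "coeff_functional \<chi> (smult a P) = a * coeff_functional \<chi> P"
  by (simp add: coeff_functional_eq[where M = "degree P"] sum_distrib_left mult.assoc degree_smult_le)

lemma coeff_functional_of_nat_mult:
  "coeff_functional \<chi> (of_nat a * P) = int a * coeff_functional \<chi> P"
  by (simp add: of_nat_poly coeff_functional_smult)

lemma coeff_functional_sum:
  "coeff_functional \<chi> (\<Sum>i\<in>I. P i) = (\<Sum>i\<in>I. coeff_functional \<chi> (P i))"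
  by (induction I rule: infinite_finite_induct) (simp_all add: coeff_functional_add)

lemma coeff_functional_monom: "coeff_functional \<chi> (monom 1 n) = \<chi> n"
proof -
  have "coeff_functional \<chi> (monom 1 n) = (\<Sum>i\<le>n. if n = i then \<chi> i else 0)"
    unfolding coeff_functional_eq[OF degree_monom_le] by (rule sum.cong) auto
  then show ?thesis by simp
qed

lemma coeff_functional_monom_mult:
  "coeff_functional \<chi> (monom 1 q * P) = coeff_functional (\<lambda>i. \<chi> (i + q)) P"
proof -
  have "degree (monom 1 q * P) \<le> degree P + q"
    using degree_mult_le[of "monom 1 q" P] degree_monom_le[of "1::int" q] by simp
  then have "coeff_functional \<chi> (monom 1 q * P) =
      (\<Sum>i\<le>degree P + q. coeff (monom 1 q * P) i * \<chi> i)"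
    by (rule coeff_functional_eq)
  also have "\<dots> = (\<Sum>i=0+q..degree P + q. coeff (monom 1 q * P) i * \<chi> i)"
    by (rule sum.mono_neutral_right) (auto simp: coeff_monom_mult)
  also have "\<dots> = (\<Sum>i=0..degree P. coeff P i * \<chi> (i + q))"
    unfolding sum.shift_bounds_cl_nat_ivl by (simp add: coeff_monom_mult)
  finally show ?thesis by (simp add: coeff_functional_def atMost_atLeast0)
qed

text \<open>Take \<open>c n\<close> to be the functional of the indicator at
  \<open>(X - 1) ^ n\<close>, that is, its \<open>n\<close>-th difference at 0. Expanding
  \<open>X ^ y\<close> in powers of \<open>X - 1\<close> gives the first claim; the ideal membership
  gives the second, as the indicator is periodic.\<close>

theorem indicator_binomial_expansion:
  assumes "prime p"
  obtains c :: "nat \<Rightarrow> int" where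
    "\<And>y. (if p ^ Suc b dvd y then 1 else 0) = (\<Sum>n\<le>y. c n * int (y choose n))"
    "\<And>n e. p ^ b * (1 + e * (p - 1)) \<le> n \<Longrightarrow> int p ^ e dvd c n"
proof
  define q where "q = p ^ Suc b"
  define \<chi> where "\<chi> = (\<lambda>y. if q dvd y then 1 else 0 :: int)"
  define X :: "int poly" where "X = monom 1 1"
  define c where "c = (\<lambda>n. coeff_functional \<chi> ((X - 1) ^ n))"
  have X: "X ^ n = monom 1 n" for n by (simp add: X_def monom_power)
  show "(if p ^ Suc b dvd y then 1 else 0) = (\<Sum>n\<le>y. c n * int (y choose n))" for y
  proof -
    have "X ^ y = ((X - 1) + 1) ^ y" by simp
    also have "\<dots> = (\<Sum>n\<le>y. of_nat (y choose n) * (X - 1) ^ n)"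
      unfolding binomial_ring by simp
    finally have "coeff_functional \<chi> (X ^ y) = (\<Sum>n\<le>y. c n * int (y choose n))"
      by (simp add: coeff_functional_sum coeff_functional_of_nat_mult c_def mult.commute)
    then show ?thesis by (simp add: X coeff_functional_monom \<chi>_def q_def)
  qed
  fix n e assume "p ^ b * (1 + e * (p - 1)) \<le> n"
  then obtain k where n: "n = p ^ b * (1 + e * (p - 1)) + k" using le_Suc_ex by blast
  obtain A B C where *: "(X - 1) ^ (p ^ b * (1 + e * (p - 1))) =
      of_nat p ^ e * ((X ^ (p ^ b) - 1) * A + of_nat p * B) + (X ^ q - 1) * C"
    using sub_one_power_in_ideal[OF assms] unfolding q_def by blast
  have "(X - 1) ^ n = of_nat (p ^ e) * (((X ^ (p ^ b) - 1) * A + of_nat p * B) * (X - 1) ^ k)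
      + (X ^ q - 1) * (C * (X - 1) ^ k)" (is "_ = of_nat (p ^ e) * ?P + (X ^ q - 1) * ?Q")
    unfolding n power_add[of "X - 1" "p ^ b * (1 + e * (p - 1))" k] * by (simp add: algebra_simps)
  \<comment> \<open>Moving \<open>?Q\<close> to the left leaves only sums; by periodicity its two
    images agree and cancel.\<close>
  then have "(X - 1) ^ n + ?Q = of_nat (p ^ e) * ?P + monom 1 q * ?Q"
    by (simp add: X algebra_simps)
  then have "coeff_functional \<chi> ((X - 1) ^ n + ?Q) = coeff_functional \<chi> (of_nat (p ^ e) * ?P + monom 1 q * ?Q)"
    by simp
  moreover have "(\<lambda>i. \<chi> (i + q)) = \<chi>" by (auto simp: \<chi>_def)
  ultimately have "c n = int (p ^ e) * coeff_functional \<chi> ?P"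
    unfolding coeff_functional_add coeff_functional_of_nat_mult coeff_functional_monom_mult
    by (simp add: c_def)
  then show "int p ^ e dvd c n" by simp
qed

subsection \<open>Counting common zeros\<close>

text \<open>Each multi-index contributes a product of coefficients times a box sum. By
  \<open>dM\<close>, a further factor \<open>p\<close> in the coefficients costs at most
  \<open>(p - 1) * M\<close> in degree, hence at most \<open>M\<close> factors \<open>p\<close> of
  the box sum. This exchange rate is the denominator.\<close>

theorem prime_power_dvd_card_common_zeros:
  fixes F :: "'c \<Rightarrow> ('i \<Rightarrow> nat) \<Rightarrow> nat"
  assumes p: "prime p" and I: "finite I" and C: "finite C" and M: "M \<ge> 1"
    and deg: "\<And>c. c \<in> C \<Longrightarrow> fdeg_less 0 (Suc (d c)) (\<lambda>x. int (F c x))"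
    and dM: "\<And>c. c \<in> C \<Longrightarrow> d c * p ^ b c \<le> M"
    and E: "int E \<le> \<lceil>(real (card I) - (\<Sum>c\<in>C. real (d c) * ((real p ^ Suc (b c) - 1) / (real p - 1)))) / real M\<rceil>"
  shows "p ^ E dvd card {x \<in> box p I. \<forall>c\<in>C. p ^ Suc (b c) dvd F c x}"
proof -
  have p2: "p \<ge> 2" using p by (rule prime_ge_2_nat)
  have "\<exists>a :: nat \<Rightarrow> int. (\<forall>y. (if p ^ Suc (b c) dvd y then 1 else 0) = (\<Sum>n\<le>y. a n * int (y choose n)))
      \<and> (\<forall>n e. p ^ b c * (1 + e * (p - 1)) \<le> n \<longrightarrow> int p ^ e dvd a n)" for c
    by (rule indicator_binomial_expansion[OF p, of "b c"]) blast
  then obtain a :: "'c \<Rightarrow> nat \<Rightarrow> int" where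
    a_exp: "\<And>c y. (if p ^ Suc (b c) dvd y then 1 else 0) = (\<Sum>n\<le>y. a c n * int (y choose n))"
    and a_dvd: "\<And>c n e. p ^ b c * (1 + e * (p - 1)) \<le> n \<Longrightarrow> int p ^ e dvd a c n"
    by metis
  have fin: "finite (box p I)"
  proof -
    have "box p I \<subseteq> (\<lambda>f i. if i \<in> I then f i else 0) ` (I \<rightarrow>\<^sub>E {..<p})"
    proof
      fix x assume "x \<in> box p I"
      then show "x \<in> (\<lambda>f i. if i \<in> I then f i else 0) ` (I \<rightarrow>\<^sub>E {..<p})"
        by (intro image_eqI[of _ _ "restrict x I"]) (auto simp: box_def fun_eq_iff)
    qed
    then show ?thesis by (rule finite_subset) (use I in \<open>simp add: finite_PiE\<close>)
  qed
  \<comment> \<open>A common cutoff turns the expansions into sums over one finite range, so that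
    their product can be multiplied out; the added terms have zero binomial coefficients.\<close>
  define L where "L = Max (insert 0 ((\<lambda>(c, x). F c x) ` (C \<times> box p I)))"
  have L: "F c x \<le> L" if "c \<in> C" "x \<in> box p I" for c x
    unfolding L_def using C fin that by (intro Max_ge) auto
  have a_exp': "(if p ^ Suc (b c) dvd F c x then 1 else 0) = (\<Sum>n\<le>L. a c n * int (F c x choose n))"
    if "c \<in> C" "x \<in> box p I" for c x
    unfolding a_exp by (rule sum.mono_neutral_left) (use L[OF that] in \<open>auto simp: binomial_eq_0\<close>)
  define G where "G = (\<lambda>\<nu> x. \<Prod>c\<in>C. int (F c x choose \<nu> c))"
  have "int (card {x \<in> box p I. \<forall>c\<in>C. p ^ Suc (b c) dvd F c x}) =
      (\<Sum>x\<in>box p I. if \<forall>c\<in>C. p ^ Suc (b c) dvd F c x then 1 else 0)"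
    using fin by (simp add: sum.If_cases Int_def)
  also have "\<dots> = (\<Sum>x\<in>box p I. \<Prod>c\<in>C. if p ^ Suc (b c) dvd F c x then 1 else 0)"
    using C by (intro sum.cong refl) (auto simp: prod_zero_iff)
  also have "\<dots> = (\<Sum>x\<in>box p I. \<Prod>c\<in>C. \<Sum>n\<le>L. a c n * int (F c x choose n))"
    by (intro sum.cong prod.cong refl a_exp')
  also have "\<dots> = (\<Sum>x\<in>box p I. \<Sum>\<nu>\<in>C \<rightarrow>\<^sub>E {..L}. (\<Prod>c\<in>C. a c (\<nu> c)) * G \<nu> x)"
    using C by (simp add: prod_sum_PiE prod.distrib G_def)
  also have "\<dots> = (\<Sum>\<nu>\<in>C \<rightarrow>\<^sub>E {..L}. (\<Prod>c\<in>C. a c (\<nu> c)) * (\<Sum>x\<in>box p I. G \<nu> x))"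
    by (subst sum.swap) (simp add: sum_distrib_left)
  also have "int p ^ E dvd \<dots>"
  proof (rule dvd_sum)
    fix \<nu> :: "'c \<Rightarrow> nat"
    \<comment> \<open>For \<open>\<nu> c >= p ^ b c\<close> this is the largest exponent that
      \<open>a_dvd\<close> yields; below that, truncation gives 0.\<close>
    define e where "e = (\<lambda>c. (\<nu> c - p ^ b c) div (p ^ b c * (p - 1)))"
    define s where "s = (\<Sum>c\<in>C. e c)"
    define S where "S = (\<Sum>c\<in>C. d c * \<nu> c)"
    have e_dvd: "int p ^ e c dvd a c (\<nu> c)" for c
    proof (cases "p ^ b c \<le> \<nu> c")
      case True
      have "e c * (p ^ b c * (p - 1)) \<le> \<nu> c - p ^ b c"
        unfolding e_def by (rule div_times_less_eq_dividend)
      moreover have "p ^ b c * (1 + e c * (p - 1)) = p ^ b c + e c * (p ^ b c * (p - 1))"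
        by (simp only: distrib_left mult_1_right mult.left_commute)
      ultimately have "p ^ b c * (1 + e c * (p - 1)) \<le> \<nu> c"
        using True by linarith
      then show ?thesis by (rule a_dvd)
    qed (simp add: e_def)
    \<comment> \<open>Maximality of \<open>e c\<close>. The strict inequality between integers
      supplies the 1 that becomes \<open>p ^ Suc (b c) - 1\<close> in the bound.\<close>
    have \<nu>: "\<nu> c + 1 \<le> p ^ Suc (b c) + e c * (p ^ b c * (p - 1))" for c
    proof -
      have "0 < p ^ b c * (p - 1)" using p2 by simp
      then have "\<nu> c - p ^ b c < e c * (p ^ b c * (p - 1)) + p ^ b c * (p - 1)"
        unfolding e_def add.commute[of "_ * (p ^ b c * (p - 1))"] by (rule dividend_less_div_times)
      moreover have "p ^ Suc (b c) = p ^ b c + p ^ b c * (p - 1)"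
        using p2 by (cases p) auto
      ultimately show ?thesis by linarith
    qed
    have "int p ^ s dvd (\<Prod>c\<in>C. a c (\<nu> c))"
      unfolding s_def power_sum by (intro prod_dvd_prod e_dvd)
    moreover have "int p ^ (card I - S div (p - 1)) dvd (\<Sum>x\<in>box p I. G \<nu> x)"
    proof -
      have "fdeg_less 0 (Suc S) (G \<nu>)"
        unfolding G_def S_def using C by (intro fdeg_less_prod fdeg_less_binomial deg)
      moreover have "Suc S \<le> (p - 1) * Suc (S div (p - 1))"
        using dividend_less_times_div[of "p - 1" S] p2 by simp
      ultimately have "fdeg_less 0 ((p - 1) * Suc (S div (p - 1))) (G \<nu>)"
        by (rule fdeg_less_mono[rotated])
      from prime_power_dvd_sum_box[OF p I this] show ?thesis by simp
    qed
    ultimately have "int p ^ (s + (card I - S div (p - 1))) dvd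
        (\<Prod>c\<in>C. a c (\<nu> c)) * (\<Sum>x\<in>box p I. G \<nu> x)"
      unfolding power_add by (rule mult_dvd_mono)
    moreover have "E \<le> s + (card I - S div (p - 1))"
    proof -
      define P where "P = real p - 1"
      have P: "P > 0" "real (p - 1) = P" using p2 by (auto simp: P_def)
      define W where "W = (\<Sum>c\<in>C. real (d c) * ((real p ^ Suc (b c) - 1) / P))"
      define T where "T = real (card I - S div (p - 1))"
      have "real S \<le> (\<Sum>c\<in>C. real (d c) * (real p ^ Suc (b c) - 1) + P * (real M * real (e c)))"
        unfolding S_def of_nat_sum
      proof (rule sum_mono)
        fix c assume c: "c \<in> C"
        have "real (\<nu> c) + 1 \<le> real p ^ Suc (b c) + real (e c) * (real p ^ b c * P)"
          using \<nu>[of c, folded of_nat_le_iff[where 'a = real]] P(2) by simp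
        then have "real (d c) * real (\<nu> c) \<le>
            real (d c) * (real p ^ Suc (b c) - 1 + real (e c) * (real p ^ b c * P))"
          by (intro mult_left_mono) auto
        also have "\<dots> = real (d c) * (real p ^ Suc (b c) - 1) + P * ((real (d c) * real p ^ b c) * real (e c))"
          by (simp add: algebra_simps)
        also have "real (d c) * real p ^ b c \<le> real M"
          using dM[OF c, folded of_nat_le_iff[where 'a = real]] by simp
        finally show "real (d c * \<nu> c) \<le> real (d c) * (real p ^ Suc (b c) - 1) + P * (real M * real (e c))"
          using P(1) by (simp add: mult_left_mono mult_right_mono)
      qed
      also have "\<dots> = P * (W + real M * real s)"
        using P(1) by (simp add: W_def s_def sum.distrib sum_distrib_left distrib_left)
      finally have "real S / P \<le> W + real M * real s"
        using P(1) by (simp add: divide_le_eq mult.commute)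
      moreover have "real (S div (p - 1)) \<le> real S / P"
        using of_nat_div_le_of_nat[of S "p - 1", where 'a = real] P(2) by simp
      \<comment> \<open>Truncated subtraction makes \<open>T\<close> nonnegative, so
        \<open>M >= 1\<close> allows \<open>T\<close> to be replaced by \<open>M * T\<close> and
        \<open>M\<close> to be factored out.\<close>
      moreover have "T \<ge> real (card I) - real (S div (p - 1))" by (simp add: T_def)
      moreover have "T \<le> real M * T" using mult_right_mono[of 1 "real M" T] M by (simp add: T_def)
      ultimately have "real (card I) - W \<le> real M * (real s + T)"
        by (simp add: distrib_left)
      then have "(real (card I) - W) / real M \<le> real s + T"
        using M by (simp add: divide_le_eq mult.commute)
      then have "\<lceil>(real (card I) - W) / real M\<rceil> \<le> int (s + (card I - S div (p - 1)))"
        by (simp add: ceiling_le_iff T_def)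
      with E show ?thesis unfolding W_def P_def by linarith
    qed
    ultimately show "int p ^ E dvd (\<Prod>c\<in>C. a c (\<nu> c)) * (\<Sum>x\<in>box p I. G \<nu> x)"
      using power_le_dvd by blast
  qed
  finally show ?thesis by (simp flip: of_nat_power)
qed

subsection \<open>Functional degrees over elementary abelian groups\<close>

lemma carrier_elem_ab_group:
  "p > 0 \<Longrightarrow> carrier (elem_ab_group p N) = ({1..N} \<rightarrow>\<^sub>E {0..<int p})"
  by (simp add: elem_ab_group_def carrier_integer_mod_group)

lemma carrier_ab_p_group:
  "p > 0 \<Longrightarrow> carrier (ab_p_group p K \<beta>) = (\<Pi>\<^sub>E k\<in>{1..K}. {0..<int (p ^ \<beta> k)})"
  by (simp add: ab_p_group_def carrier_sum_group carrier_integer_mod_group)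

lemma group_elem_ab_group: "group (elem_ab_group p N)"
  by (simp add: elem_ab_group_def)

lemma group_ab_p_group: "group (ab_p_group p K \<beta>)"
  by (simp add: ab_p_group_def)

lemma one_ab_p_group: "\<one>\<^bsub>ab_p_group p K \<beta>\<^esub> = (\<lambda>k\<in>{1..K}. 0)"
  by (simp add: ab_p_group_def)

text \<open>Components are reduced representatives, so only 0 is divisible by the modulus.
  Divisibility is the form that survives replacing values by congruent integers.\<close>

lemma ab_p_group_eq_one_iff:
  assumes "p > 0" "u \<in> carrier (ab_p_group p K \<beta>)"
  shows "u = \<one>\<^bsub>ab_p_group p K \<beta>\<^esub> \<longleftrightarrow> (\<forall>k\<in>{1..K}. int (p ^ \<beta> k) dvd u k)"
proof -
  have u: "u k \<in> {0..<int (p ^ \<beta> k)}" if "k \<in> {1..K}" for k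
    using assms that by (auto simp: carrier_ab_p_group)
  have "int (p ^ \<beta> k) dvd u k \<longleftrightarrow> u k = 0" if "k \<in> {1..K}" for k
    using u[OF that] zdvd_imp_le[of "int (p ^ \<beta> k)" "u k"] by fastforce
  moreover have "u = \<one>\<^bsub>ab_p_group p K \<beta>\<^esub> \<longleftrightarrow> (\<forall>k\<in>{1..K}. u k = 0)"
    using assms by (auto simp: carrier_ab_p_group one_ab_p_group fun_eq_iff PiE_iff extensional_def)
  ultimately show ?thesis by simp
qed

lemma ab_p_group_diff_component:
  assumes "p > 0" "u \<in> carrier (ab_p_group p K \<beta>)" "v \<in> carrier (ab_p_group p K \<beta>)" "k \<in> {1..K}"
  shows "int (p ^ \<beta> k) dvd (u k - v k) -
    (u \<otimes>\<^bsub>ab_p_group p K \<beta>\<^esub> inv\<^bsub>ab_p_group p K \<beta>\<^esub> v) k"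
proof -
  have "v k \<in> carrier (integer_mod_group (p ^ \<beta> k))"
    using assms by (auto simp: carrier_ab_p_group carrier_integer_mod_group)
  then have "(u \<otimes>\<^bsub>ab_p_group p K \<beta>\<^esub> inv\<^bsub>ab_p_group p K \<beta>\<^esub> v) k = (u k - v k) mod int (p ^ \<beta> k)"
    using assms by (simp add: ab_p_group_def mod_add_right_eq)
  then show ?thesis by (simp add: mod_eq_dvd_iff[symmetric])
qed

text \<open>The additive map onto the group along which functions are pulled back to vectors of
  naturals; its values are extensional, like the elements of the carrier.\<close>

definition residue_vec :: "nat \<Rightarrow> nat \<Rightarrow> (nat \<Rightarrow> nat) \<Rightarrow> nat \<Rightarrow> int" where
  "residue_vec p N x = (\<lambda>i\<in>{1..N}. int (x i mod p))"

lemma residue_vec_in_carrier: "p > 0 \<Longrightarrow> residue_vec p N x \<in> carrier (elem_ab_group p N)"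
  by (auto simp: residue_vec_def carrier_elem_ab_group)

lemma residue_vec_add:
  "residue_vec p N x \<otimes>\<^bsub>elem_ab_group p N\<^esub> residue_vec p N a = residue_vec p N (x + a)"
  by (auto simp: residue_vec_def elem_ab_group_def fun_eq_iff mod_add_eq simp flip: of_nat_add of_nat_mod)

lemma bij_betw_residue_vec:
  assumes "p > 0"
  shows "bij_betw (residue_vec p N) (box p {1..N}) (carrier (elem_ab_group p N))"
proof (rule bij_betw_byWitness[where f' = "\<lambda>y i. if i \<in> {1..N} then nat (y i) else 0"])
  show "\<forall>y\<in>carrier (elem_ab_group p N).
      residue_vec p N (\<lambda>i. if i \<in> {1..N} then nat (y i) else 0) = y"
  proof
    fix y assume y: "y \<in> carrier (elem_ab_group p N)"
    have "int (nat (y i) mod p) = y i" if "i \<in> {1..N}" for i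
    proof -
      have "0 \<le> y i" "y i < int p"
        using y that assms by (auto simp: carrier_elem_ab_group dest: PiE_mem)
      then show ?thesis by (simp add: zmod_int)
    qed
    then show "residue_vec p N (\<lambda>i. if i \<in> {1..N} then nat (y i) else 0) = y"
      using y assms
      by (auto simp: residue_vec_def fun_eq_iff carrier_elem_ab_group PiE_iff extensional_def)
  qed
  show "(\<lambda>y i. if i \<in> {1..N} then nat (y i) else 0) ` carrier (elem_ab_group p N) \<subseteq> box p {1..N}"
    using assms by (fastforce simp: box_def carrier_elem_ab_group PiE_iff)
qed (use assms in \<open>auto simp: residue_vec_def box_def fun_eq_iff carrier_elem_ab_group\<close>)

text \<open>Integer differences of a component agree with group differences modulo
  \<open>p ^ \<beta> k\<close>. Membership in the carrier is carried through the induction because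
  the component rule for group differences requires it.\<close>

lemma foldr_fdelta_component:
  fixes p N K :: nat and \<beta> :: "nat \<Rightarrow> nat"
  defines "A \<equiv> elem_ab_group p N" and "B \<equiv> ab_p_group p K \<beta>"
  assumes p: "p > 0" and f: "f \<in> carrier A \<rightarrow> carrier B" and k: "k \<in> {1..K}"
  shows "foldr (fdelta A B) (map (residue_vec p N) as) f \<in> carrier A \<rightarrow> carrier B \<and>
    (\<forall>x. int (p ^ \<beta> k) dvd foldr diff_at as (\<lambda>x. f (residue_vec p N x) k) x -
      foldr (fdelta A B) (map (residue_vec p N) as) f (residue_vec p N x) k)"
proof (induction as)
  case Nil
  show ?case using f by simp
next
  case (Cons a as)
  interpret A: group A unfolding A_def by (rule group_elem_ab_group)
  interpret B: group B unfolding B_def by (rule group_ab_p_group)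
  let ?g = "foldr diff_at as (\<lambda>x. f (residue_vec p N x) k)"
  let ?h = "foldr (fdelta A B) (map (residue_vec p N) as) f"
  let ?\<rho> = "residue_vec p N"
  have h: "?h \<in> carrier A \<rightarrow> carrier B"
    and gh: "\<And>x. int (p ^ \<beta> k) dvd ?g x - ?h (?\<rho> x) k"
    using Cons.IH by blast+
  have \<rho>: "?\<rho> x \<in> carrier A" for x unfolding A_def using p by (rule residue_vec_in_carrier)
  have "fdelta A B (?\<rho> a) ?h \<in> carrier A \<rightarrow> carrier B"
    using h \<rho>[of a] by (auto simp: fdelta_def Pi_iff)
  moreover have "int (p ^ \<beta> k) dvd diff_at a ?g x - fdelta A B (?\<rho> a) ?h (?\<rho> x) k" for x
  proof -
    have "int (p ^ \<beta> k) dvd (?h (?\<rho> (x + a)) k - ?h (?\<rho> x) k) - fdelta A B (?\<rho> a) ?h (?\<rho> x) k"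
      using ab_p_group_diff_component[OF p _ _ k, of "?h (?\<rho> (x + a))" \<beta> "?h (?\<rho> x)", folded B_def]
        funcset_mem[OF h \<rho>]
      by (simp add: fdelta_def[of A B "?\<rho> a" ?h] residue_vec_add[of p N, folded A_def])
    from dvd_add[OF dvd_diff[OF gh[of "x + a"] gh[of x]] this]
    have "int (p ^ \<beta> k) dvd (?g (x + a) - ?h (?\<rho> (x + a)) k) - (?g x - ?h (?\<rho> x) k) +
        ((?h (?\<rho> (x + a)) k - ?h (?\<rho> x) k) - fdelta A B (?\<rho> a) ?h (?\<rho> x) k)" .
    then show ?thesis by (simp add: diff_at_def algebra_simps)
  qed
  ultimately show ?case by simp
qed

section \<open>Possible values of the functional degree and their consequences\<close>

lemma foldr_fdelta_eq_one:
  assumes "fdeg A B f = ereal (real d)" "length as > d" "set as \<subseteq> carrier A" "x \<in> carrier A"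
  shows "foldr (fdelta A B) as f x = \<one>\<^bsub>B\<^esub>"
proof (rule ccontr)
  assume "foldr (fdelta A B) as f x \<noteq> \<one>\<^bsub>B\<^esub>"
  with assms have "ereal (real (length as)) \<le> fdeg A B f"
    unfolding fdeg_def by (intro Sup_upper) auto
  with assms show False by simp
qed

text \<open>The empty list of differences is a witness for degree 0, which rules out minus infinity;
  a nonempty set of naturals has a maximum or is unbounded.\<close>

lemma fdeg_infinite_or_nat:
  assumes "\<exists>x\<in>carrier A. f x \<noteq> \<one>\<^bsub>B\<^esub>"
  shows "fdeg A B f = \<infinity> \<or> (\<exists>d. fdeg A B f = ereal (real d))"
proof -
  define S where "S = {length as | as. set as \<subseteq> carrier A \<and>
     (\<exists>x\<in>carrier A. foldr (fdelta A B) as f x \<noteq> \<one>\<^bsub>B\<^esub>)}"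
  have fdeg: "fdeg A B f = Sup ((\<lambda>n. ereal (real n)) ` S)"
    unfolding fdeg_def S_def by (rule arg_cong[where f = Sup]) auto
  have "0 \<in> S" using assms by (force simp: S_def)
  show ?thesis
  proof (cases "finite S")
    case True
    have "Max S \<in> S" using True \<open>0 \<in> S\<close> by (intro Max_in) auto
    then have "Sup ((\<lambda>n. ereal (real n)) ` S) = ereal (real (Max S))"
      using True by (intro cSup_eq_maximum imageI) auto
    then show ?thesis by (auto simp: fdeg)
  next
    case False
    have "fdeg A B f \<ge> ereal b" for b
    proof -
      obtain n where "n \<in> S" "n > nat \<lceil>b\<rceil>"
        using False by (auto simp: infinite_nat_iff_unbounded)
      then have "ereal b \<le> ereal (real n)" by simp linarith
      also have "\<dots> \<le> fdeg A B f" unfolding fdeg using \<open>n \<in> S\<close> by (intro Sup_upper) auto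
      finally show ?thesis .
    qed
    then show ?thesis using ereal_top by blast
  qed
qed

lemma fdeg_less_component:
  fixes p N K :: nat and \<beta> :: "nat \<Rightarrow> nat"
  defines "A \<equiv> elem_ab_group p N" and "B \<equiv> ab_p_group p K \<beta>"
  assumes p: "p > 0" and f: "f \<in> carrier A \<rightarrow> carrier B" and k: "k \<in> {1..K}"
    and d: "fdeg A B f = ereal (real d)"
  shows "fdeg_less (int (p ^ \<beta> k)) (Suc d) (\<lambda>x. f (residue_vec p N x) k)"
proof (rule fdeg_less_if_foldr)
  fix as :: "(nat \<Rightarrow> nat) list" and x assume "length as = Suc d"
  have \<rho>: "residue_vec p N x \<in> carrier A" for x
    unfolding A_def using p by (rule residue_vec_in_carrier)
  have "foldr (fdelta A B) (map (residue_vec p N) as) f (residue_vec p N x) = \<one>\<^bsub>B\<^esub>"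
    using \<open>length as = Suc d\<close> \<rho> by (intro foldr_fdelta_eq_one[OF d]) auto
  then have "foldr (fdelta A B) (map (residue_vec p N) as) f (residue_vec p N x) k = 0"
    using k by (simp add: B_def one_ab_p_group)
  moreover have "int (p ^ \<beta> k) dvd foldr diff_at as (\<lambda>x. f (residue_vec p N x) k) x -
      foldr (fdelta A B) (map (residue_vec p N) as) f (residue_vec p N x) k"
    using foldr_fdelta_component[OF p f[unfolded A_def B_def] k] unfolding A_def B_def by blast
  ultimately show "int (p ^ \<beta> k) dvd foldr diff_at as (\<lambda>x. f (residue_vec p N x) k) x"
    by simp
qed

text \<open>The difference at \<open>y\<close> in direction \<open>a\<close>, chosen to carry
  \<open>y\<close> to \<open>x\<close>, compares the two values. This settles the case of a zero
  denominator.\<close>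

lemma fdeg_zero_imp_constant:
  assumes "group A" "group B" "f \<in> carrier A \<rightarrow> carrier B" "fdeg A B f = 0"
    "x \<in> carrier A" "y \<in> carrier A"
  shows "f x = f y"
proof -
  interpret A: group A by fact
  interpret B: group B by fact
  define a where "a = inv\<^bsub>A\<^esub> y \<otimes>\<^bsub>A\<^esub> x"
  have a: "a \<in> carrier A" "y \<otimes>\<^bsub>A\<^esub> a = x" using assms by (auto simp: a_def simp flip: A.m_assoc)
  have "fdeg A B f = ereal (real 0)" using assms(4) by (simp add: zero_ereal_def)
  from foldr_fdelta_eq_one[OF this, of "[a]" y] have "f x \<otimes>\<^bsub>B\<^esub> inv\<^bsub>B\<^esub> f y = \<one>\<^bsub>B\<^esub>"
    using a assms by (simp add: fdelta_def)
  moreover have "f x \<in> carrier B" "f y \<in> carrier B" using assms by auto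
  ultimately show ?thesis by (metis B.inv_closed B.inv_equality B.inv_inv)
qed

section \<open>From common zeros in the group to common zeros in the box\<close>

theorem mainTheorem3:
  fixes N r p :: nat
    and K :: "nat \<Rightarrow> nat"
    and \<beta> :: "nat \<Rightarrow> nat \<Rightarrow> nat"
    and f :: "nat \<Rightarrow> (nat \<Rightarrow> int) \<Rightarrow> (nat \<Rightarrow> int)"
    and Z :: "(nat \<Rightarrow> int) set"
    and d :: "nat \<Rightarrow> ereal"
    and D :: ereal
  assumes "N \<ge> 1" and "r \<ge> 1" and "prime p"
    and "\<And>j. j \<in> {1..r} \<Longrightarrow> K j \<ge> 1"
    and "\<And>j k l. \<lbrakk>j \<in> {1..r}; 1 \<le> k; k \<le> l; l \<le> K j\<rbrakk> \<Longrightarrow> \<beta> j l \<le> \<beta> j k"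
    and "\<And>j k. \<lbrakk>j \<in> {1..r}; k \<in> {1..K j}\<rbrakk> \<Longrightarrow> \<beta> j k \<ge> 1"
    and "\<And>j. j \<in> {1..r} \<Longrightarrow>
           f j \<in> carrier (elem_ab_group p N) \<rightarrow> carrier (ab_p_group p (K j) (\<beta> j))"
    and "\<And>j. j \<in> {1..r} \<Longrightarrow>
           \<exists>x\<in>carrier (elem_ab_group p N). f j x \<noteq> \<one>\<^bsub>ab_p_group p (K j) (\<beta> j)\<^esub>"
    and "Z = {x \<in> carrier (elem_ab_group p N).
               \<forall>j\<in>{1..r}. f j x = \<one>\<^bsub>ab_p_group p (K j) (\<beta> j)\<^esub>}"
    and "\<And>j. d j = fdeg (elem_ab_group p N) (ab_p_group p (K j) (\<beta> j)) (f j)"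
    and "D = (MAX j\<in>{1..r}. ereal (real p ^ (\<beta> j 1 - 1)) * d j)"
  shows "padic_ord p (card Z) \<ge>
    (if D = 0 then \<infinity>
     else ereal_ceiling
       ((ereal (real N) -
          (\<Sum>j=1..r. d j * ereal (\<Sum>k=1..K j. (real p ^ \<beta> j k - 1) / (real p - 1)))) / D))"
proof -
  let ?A = "elem_ab_group p N"
  let ?B = "\<lambda>j. ab_p_group p (K j) (\<beta> j)"
  note \<beta>_mono = assms(5) and \<beta>_pos = assms(6) and f = assms(7)
    and f_nonzero = assms(8) and Z = assms(9) and d = assms(10) and D = assms(11)
  have p0: "p > 0" using assms(3) by (rule prime_gt_0_nat)
  have D_ge: "ereal (real p ^ (\<beta> j 1 - 1)) * d j \<le> D" if "j \<in> {1..r}" for j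
    unfolding D using that by (intro Max_ge) auto
  have D_in: "\<exists>j\<in>{1..r}. D = ereal (real p ^ (\<beta> j 1 - 1)) * d j"
  proof -
    have "D \<in> (\<lambda>j. ereal (real p ^ (\<beta> j 1 - 1)) * d j) ` {1..r}"
      unfolding D using assms(2) by (intro Max_in) auto
    then show ?thesis by blast
  qed
  have d_cases: "d j = \<infinity> \<or> (\<exists>n. d j = ereal (real n))" if "j \<in> {1..r}" for j
    unfolding d using f_nonzero[OF that] by (rule fdeg_infinite_or_nat)
  show ?thesis
  proof (cases "\<exists>j\<in>{1..r}. d j = \<infinity>")
    case True
    then obtain j where "j \<in> {1..r}" "d j = \<infinity>" by blast
    \<comment> \<open>Here the right-hand side has the junk value \<open>- \<infinity> / \<infinity> = 0\<close>.\<close>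
    then have "D = \<infinity>" using D_ge[of j] p0 by simp
    then show ?thesis by (simp add: padic_ord_def ereal_ceiling_def divide_ereal_def)
  next
    case False
    with d_cases have "\<forall>j\<in>{1..r}. \<exists>n. d j = ereal (real n)" by blast
    then obtain \<delta> where \<delta>: "\<And>j. j \<in> {1..r} \<Longrightarrow> d j = ereal (real (\<delta> j))" by metis
    obtain j0 where j0: "j0 \<in> {1..r}" "D = ereal (real p ^ (\<beta> j0 1 - 1)) * d j0" using D_in by blast
    define M where "M = p ^ (\<beta> j0 1 - 1) * \<delta> j0"
    have DM: "D = ereal (real M)" by (simp add: j0(2) \<delta>[OF j0(1)] M_def)
    have M_ge: "p ^ (\<beta> j 1 - 1) * \<delta> j \<le> M" if "j \<in> {1..r}" for j
    proof -
      have "ereal (real (p ^ (\<beta> j 1 - 1) * \<delta> j)) \<le> ereal (real M)"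
        using D_ge[OF that] by (simp add: DM \<delta>[OF that])
      then show ?thesis by (simp only: ereal_less_eq of_nat_le_iff)
    qed
    show ?thesis
    proof (cases "M = 0")
      case True
      have 1: "1 \<in> {1..r}" using assms(2) by simp
      \<comment> \<open>A zero maximum makes \<open>f 1\<close> a nonzero constant, so
        \<open>Z\<close> is empty and its order is infinite.\<close>
      from M_ge[OF 1] True p0 have "\<delta> 1 = 0" by simp
      then have "d 1 = 0" using \<delta>[OF 1] by (simp only: of_nat_0 zero_ereal_def)
      then have "fdeg ?A (?B 1) (f 1) = 0" by (simp add: d)
      note const = fdeg_zero_imp_constant[OF group_elem_ab_group group_ab_p_group f[OF 1] this]
      obtain x0 where x0: "x0 \<in> carrier ?A" "f 1 x0 \<noteq> \<one>\<^bsub>?B 1\<^esub>" using f_nonzero[OF 1] by blast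
      have "f 1 x \<noteq> \<one>\<^bsub>?B 1\<^esub>" if "x \<in> carrier ?A" for x
        using const[OF that x0(1)] x0(2) by simp
      then have "Z = {}" using 1 unfolding Z by blast
      then show ?thesis by (simp add: padic_ord_def)
    next
      case False
      \<comment> \<open>One scalar condition for each component \<open>k\<close> of each
        \<open>f j\<close>.\<close>
      define C where "C = Sigma {1..r} (\<lambda>j. {1..K j})"
      have "\<exists>F. fdeg_less 0 (Suc (\<delta> j)) (\<lambda>x. int (F x)) \<and>
          (\<forall>x\<in>box p {1..N}. int (p ^ \<beta> j k) dvd int (F x) - f j (residue_vec p N x) k)"
        if "(j, k) \<in> C" for j k
      proof -
        have j: "j \<in> {1..r}" and k: "k \<in> {1..K j}" using that by (auto simp: C_def)
        have "fdeg ?A (?B j) (f j) = ereal (real (\<delta> j))" using \<delta>[OF j] by (simp only: d)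
        from fdeg_less_component[OF p0 f[OF j] k this] show ?thesis
          using p0 by (intro integer_lift) auto
      qed
      then have "\<forall>c\<in>C. \<exists>F. fdeg_less 0 (Suc (\<delta> (fst c))) (\<lambda>x. int (F x)) \<and>
          (\<forall>x\<in>box p {1..N}. int (p ^ \<beta> (fst c) (snd c)) dvd
            int (F x) - f (fst c) (residue_vec p N x) (snd c))"
        by auto
      then obtain F where F: "\<And>c. c \<in> C \<Longrightarrow> fdeg_less 0 (Suc (\<delta> (fst c))) (\<lambda>x. int (F c x))"
        and F_cong: "\<And>c x. c \<in> C \<Longrightarrow> x \<in> box p {1..N} \<Longrightarrow>
          int (p ^ \<beta> (fst c) (snd c)) dvd int (F c x) - f (fst c) (residue_vec p N x) (snd c)"
        by metis
      define b where "b = (\<lambda>c. \<beta> (fst c) (snd c) - 1)"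
      have b: "Suc (b c) = \<beta> (fst c) (snd c)" if "c \<in> C" for c
        using that \<beta>_pos[of "fst c" "snd c"] by (auto simp: b_def C_def)
      define Y where "Y = {x \<in> box p {1..N}. \<forall>c\<in>C. p ^ Suc (b c) dvd F c x}"
      have Y_iff: "x \<in> Y \<longleftrightarrow> residue_vec p N x \<in> Z" if x: "x \<in> box p {1..N}" for x
      proof -
        have \<rho>: "residue_vec p N x \<in> carrier ?A" using p0 by (rule residue_vec_in_carrier)
        have F_iff: "p ^ Suc (b c) dvd F c x \<longleftrightarrow>
            int (p ^ \<beta> (fst c) (snd c)) dvd f (fst c) (residue_vec p N x) (snd c)" if "c \<in> C" for c
          using F_cong[OF that x] unfolding b[OF that] of_nat_dvd_iff[symmetric, where 'a = int]
          by (metis diff_add_cancel dvd_add_right_iff)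
        have "residue_vec p N x \<in> Z \<longleftrightarrow> (\<forall>j\<in>{1..r}. \<forall>k\<in>{1..K j}.
            int (p ^ \<beta> j k) dvd f j (residue_vec p N x) k)"
          unfolding Z using \<rho> ab_p_group_eq_one_iff[OF p0 funcset_mem[OF f \<rho>]] by simp
        also have "\<dots> \<longleftrightarrow> (\<forall>c\<in>C. p ^ Suc (b c) dvd F c x)"
          using F_iff by (auto simp: C_def)
        finally show ?thesis using x by (simp add: Y_def)
      qed
      have "bij_betw (residue_vec p N) Y Z"
      proof (rule bij_betw_subset[OF bij_betw_residue_vec[OF p0, of N]])
        show "Y \<subseteq> box p {1..N}" by (auto simp: Y_def)
        show "residue_vec p N ` Y = Z"
        proof
          show "residue_vec p N ` Y \<subseteq> Z" using Y_iff by (auto simp: Y_def)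
          show "Z \<subseteq> residue_vec p N ` Y"
          proof
            fix z assume "z \<in> Z"
            moreover from this have "z \<in> carrier ?A" by (simp add: Z)
            then obtain x where "x \<in> box p {1..N}" "z = residue_vec p N x"
              using bij_betw_imp_surj_on[OF bij_betw_residue_vec[OF p0, of N]] by blast
            ultimately show "z \<in> residue_vec p N ` Y" using Y_iff by auto
          qed
        qed
      qed
      then have card: "card Z = card Y" by (simp add: bij_betw_same_card)
      define W where "W = (\<Sum>c\<in>C. real (\<delta> (fst c)) * ((real p ^ Suc (b c) - 1) / (real p - 1)))"
      have "W = (\<Sum>j=1..r. \<Sum>k=1..K j. real (\<delta> j) * ((real p ^ \<beta> j k - 1) / (real p - 1)))"
      proof -
        have "W = (\<Sum>(j, k)\<in>C. real (\<delta> j) * ((real p ^ \<beta> j k - 1) / (real p - 1)))"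
          unfolding W_def by (rule sum.cong) (auto simp: b simp del: power_Suc)
        then show ?thesis unfolding C_def by (subst sum.Sigma) auto
      qed
      then have "W = (\<Sum>j=1..r. real (\<delta> j) * (\<Sum>k=1..K j. (real p ^ \<beta> j k - 1) / (real p - 1)))"
        by (simp add: sum_distrib_left)
      then have W: "(\<Sum>j=1..r. d j * ereal (\<Sum>k=1..K j. (real p ^ \<beta> j k - 1) / (real p - 1))) = ereal W"
        by (simp add: \<delta>)
      define e where "e = \<lceil>(real N - W) / real M\<rceil>"
      \<comment> \<open>A negative \<open>e\<close> needs no divisibility, since multiplicities are
        nonnegative.\<close>
      have "p ^ nat e dvd card Y \<or> e < 0"
      proof (cases "e < 0")
        case e_nonneg: False
        have "p ^ nat e dvd card Y" unfolding Y_def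
        proof (rule prime_power_dvd_card_common_zeros[where M = M and d = "\<lambda>c. \<delta> (fst c)"])
          show "prime p" "finite {1..N}" by (use assms in auto)
          show "finite C" by (auto simp: C_def)
          show "1 \<le> M" using False by simp
          show "fdeg_less 0 (Suc (\<delta> (fst c))) (\<lambda>x. int (F c x))" if "c \<in> C" for c
            using that by (rule F)
          show "\<delta> (fst c) * p ^ b c \<le> M" if c: "c \<in> C" for c
          proof -
            \<comment> \<open>The exponents decrease in \<open>k\<close>, so the first component
              dominates; this explains \<open>\<beta> j 1\<close> in the denominator.\<close>
            have "b c \<le> \<beta> (fst c) 1 - 1"
              using c \<beta>_mono[of "fst c" 1 "snd c"] by (auto simp: b_def C_def)
            then have "p ^ b c \<le> p ^ (\<beta> (fst c) 1 - 1)" using p0 by (intro power_increasing) auto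
            then have "\<delta> (fst c) * p ^ b c \<le> p ^ (\<beta> (fst c) 1 - 1) * \<delta> (fst c)" by (simp add: mult.commute)
            also have "\<dots> \<le> M" using c by (intro M_ge) (auto simp: C_def)
            finally show ?thesis .
          qed
          show "int (nat e) \<le> \<lceil>(real (card {1..N}) -
              (\<Sum>c\<in>C. real (\<delta> (fst c)) * ((real p ^ Suc (b c) - 1) / (real p - 1)))) / real M\<rceil>"
            using e_nonneg by (simp add: e_def W_def del: power_Suc)
        qed
        then show ?thesis by simp
      qed simp
      then have "ereal (real_of_int e) \<le> padic_ord p (card Z)"
      proof (cases "card Z = 0")
        case nz: False
        have "e \<le> int (multiplicity p (card Z))"
          using \<open>p ^ nat e dvd card Y \<or> e < 0\<close>
        proof
          assume "p ^ nat e dvd card Y"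
          then have "nat e \<le> multiplicity p (card Z)"
            unfolding card using nz[unfolded card] assms(3)
            by (intro multiplicity_geI) (auto simp: not_prime_unit)
          then show ?thesis by linarith
        qed linarith
        then show ?thesis using nz by (simp add: padic_ord_def)
      qed (simp add: padic_ord_def)
      then show ?thesis using False unfolding W DM by (simp add: e_def ereal_ceiling_def)
    qed
  qed
qed

end
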